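(* Let $\mathbb{C}_1$ and $\mathbb{C}_2$ be process calculi such that $\mathbb{C}_1$ is not replacement free and $\mathbb{C}_2$ is replacement free. Then there is no independence preserving basic encoding of $\mathbb{C}_1$ into $\mathbb{C}_2$.
   Context: A process calculus consists of processes built from operators, contexts, a set $\mathrm{fn}(P)$ of free names of each process $P$, and a labelled transition semantics whose labels are actions, each either visible or the invisible action $\tau$. $P$ is closed if $\mathrm{fn}(P)=\emptyset$. A $k$-hole context is a term in which $k$ sub-terms are replaced by holes; $C[P_1,\dots,P_k]$ denotes the filling of the holes. $\Rightarrow$ is the reflexive-transitive closure of $\xrightarrow{\tau}$. $P\Downarrow$ ($P$ is visible) iff there exist a visible action $\alpha$ and $P'$ with $P\Rightarrow\xrightarrow{\alpha}\Rightarrow P'$; $P$ is invisible iff not $P\Downarrow$. A calculus is replacement free if for every (1-hole) context $C$, every closed invisible process $I$ and every process $P$ of the calculus, $C[I]\Downarrow$ implies $C[P]\Downarrow$. An encoding $[\![\cdot]\!]$ of $\mathbb{C}_1$ into $\mathbb{C}_2$ is basic if it is compositional (for every $k$-ary operator $op$ of $\mathbb{C}_1$ there is a $k$-hole context $C_{op}$ of $\mathbb{C}_2$ with $[\![op(P_1,\dots,P_k)]\!]=C_{op}[[\![P_1]\!],\dots,[\![P_k]\!]]$) and interaction sensitive ($P\Downarrow$ iff $[\![P]\!]\Downarrow$ for every $P$). Two processes $P,Q$ are independent if $\mathrm{fn}(P)\cap\mathrm{fn}(Q)=\emptyset$; an encoding is independence preserving if whenever $P$ and $Q$ are independent, so are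 $[\![P]\!]$ and $[\![Q]\!]$. *)

theory Defs
  imports Main "HOL-Library.FuncSet" "HOL-Library.Multiset"
begin

text \<open>
  A process calculus is given by operator symbols with arities, their action on processes,
  free names, and a labelled transition system with one distinguished invisible label.
  The operators are not required to be free, so that processes may be identified up to
  alpha-conversion; the term algebra is the instance in which \<open>app\<close> is a constructor.
  Name-binding and prefixing constructs are families of operators indexed by the names
  they mention, e.g. one unary operator for each input prefix.
\<close>

record ('p, 'f, 'n, 'a) calculus =
  ops :: "'f set"
  arity :: "'f \<Rightarrow> nat"
  app :: "'f \<Rightarrow> 'p list \<Rightarrow> 'p"
  free_names :: "'p \<Rightarrow> 'n set"
  tau :: 'a
  step :: "'p \<Rightarrow> 'a \<Rightarrow> 'p \<Rightarrow> bool"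

inductive_set procs :: "('p, 'f, 'n, 'a) calculus \<Rightarrow> 'p set"
  for C :: "('p, 'f, 'n, 'a) calculus" where
  op: "f \<in> ops C \<Longrightarrow> length Ps = arity C f \<Longrightarrow> \<forall>P\<in>set Ps. P \<in> procs C
        \<Longrightarrow> app C f Ps \<in> procs C"

locale process_calculus =
  fixes C :: "('p, 'f, 'n, 'a) calculus"
  assumes step_closed: "P \<in> procs C \<Longrightarrow> step C P a P' \<Longrightarrow> P' \<in> procs C"

definition weak_tau :: "('p, 'f, 'n, 'a) calculus \<Rightarrow> 'p \<Rightarrow> 'p \<Rightarrow> bool" where
  "weak_tau C = (\<lambda>P P'. step C P (tau C) P')\<^sup>*\<^sup>*"

definition visible :: "('p, 'f, 'n, 'a) calculus \<Rightarrow> 'p \<Rightarrow> bool" where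
  "visible C P \<longleftrightarrow>
     (\<exists>a P1 P2 P'. a \<noteq> tau C \<and> weak_tau C P P1 \<and> step C P1 a P2 \<and> weak_tau C P2 P')"

definition closed_proc :: "('p, 'f, 'n, 'a) calculus \<Rightarrow> 'p \<Rightarrow> bool" where
  "closed_proc C P \<longleftrightarrow> free_names C P = {}"

definition independent :: "('p, 'f, 'n, 'a) calculus \<Rightarrow> 'p \<Rightarrow> 'p \<Rightarrow> bool" where
  "independent C P Q \<longleftrightarrow> free_names C P \<inter> free_names C Q = {}"

datatype 'f ctxt = Hole nat | Node 'f "'f ctxt list"

primrec holes :: "'f ctxt \<Rightarrow> nat list" where
  "holes (Hole i) = [i]"
| "holes (Node f cs) = concat (map holes cs)"

inductive wf_ctxt :: "('p, 'f, 'n, 'a) calculus \<Rightarrow> 'f ctxt \<Rightarrow> bool"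
  for C :: "('p, 'f, 'n, 'a) calculus" where
  hole: "wf_ctxt C (Hole i)"
| node: "f \<in> ops C \<Longrightarrow> length cs = arity C f \<Longrightarrow> \<forall>c\<in>set cs. wf_ctxt C c
          \<Longrightarrow> wf_ctxt C (Node f cs)"

text \<open>
  The holes of a \<open>k\<close>-hole context are numbered \<open>0, \<dots>, k - 1\<close>. Each of them occurs exactly
  once, in an arbitrary left-to-right order.
\<close>

definition hole_ctxt :: "('p, 'f, 'n, 'a) calculus \<Rightarrow> nat \<Rightarrow> 'f ctxt \<Rightarrow> bool" where
  "hole_ctxt C k c \<longleftrightarrow> wf_ctxt C c \<and> mset (holes c) = mset [0..<k]"

text \<open>Filling is purely syntactic: free names of the fillers may be captured.\<close>

primrec fill :: "('p, 'f, 'n, 'a) calculus \<Rightarrow> 'f ctxt \<Rightarrow> 'p list \<Rightarrow> 'p" where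
  "fill C (Hole i) Ps = Ps ! i"
| "fill C (Node f cs) Ps = app C f (map (\<lambda>c. fill C c Ps) cs)"

definition replacement_free :: "('p, 'f, 'n, 'a) calculus \<Rightarrow> bool" where
  "replacement_free C \<longleftrightarrow>
     (\<forall>c I P. hole_ctxt C 1 c \<longrightarrow> I \<in> procs C \<longrightarrow> closed_proc C I \<longrightarrow> \<not> visible C I \<longrightarrow>
        P \<in> procs C \<longrightarrow> visible C (fill C c [I]) \<longrightarrow> visible C (fill C c [P]))"

definition encoding ::
  "('p, 'f, 'n, 'a) calculus \<Rightarrow> ('q, 'g, 'm, 'b) calculus \<Rightarrow> ('p \<Rightarrow> 'q) \<Rightarrow> bool" where
  "encoding C D enc \<longleftrightarrow> enc \<in> procs C \<rightarrow> procs D"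

definition compositional ::
  "('p, 'f, 'n, 'a) calculus \<Rightarrow> ('q, 'g, 'm, 'b) calculus \<Rightarrow> ('p \<Rightarrow> 'q) \<Rightarrow> bool" where
  "compositional C D enc \<longleftrightarrow>
     (\<forall>f\<in>ops C. \<exists>c. hole_ctxt D (arity C f) c \<and>
        (\<forall>Ps. length Ps = arity C f \<longrightarrow> set Ps \<subseteq> procs C \<longrightarrow>
           enc (app C f Ps) = fill D c (map enc Ps)))"

definition interaction_sensitive ::
  "('p, 'f, 'n, 'a) calculus \<Rightarrow> ('q, 'g, 'm, 'b) calculus \<Rightarrow> ('p \<Rightarrow> 'q) \<Rightarrow> bool" where
  "interaction_sensitive C D enc \<longleftrightarrow> (\<forall>P\<in>procs C. visible C P \<longleftrightarrow> visible D (enc P))"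

definition basic_encoding ::
  "('p, 'f, 'n, 'a) calculus \<Rightarrow> ('q, 'g, 'm, 'b) calculus \<Rightarrow> ('p \<Rightarrow> 'q) \<Rightarrow> bool" where
  "basic_encoding C D enc \<longleftrightarrow>
     encoding C D enc \<and> compositional C D enc \<and> interaction_sensitive C D enc"

definition independence_preserving ::
  "('p, 'f, 'n, 'a) calculus \<Rightarrow> ('q, 'g, 'm, 'b) calculus \<Rightarrow> ('p \<Rightarrow> 'q) \<Rightarrow> bool" where
  "independence_preserving C D enc \<longleftrightarrow>
     (\<forall>P\<in>procs C. \<forall>Q\<in>procs C. independent C P Q \<longrightarrow> independent D (enc P) (enc Q))"

end

theory Submission
  imports Defs
begin

text \<open>
  A closed process is independent of itself, so an independence preserving encoding sends
  closed processes to closed processes. By compositionality every 1-hole context \<open>c\<close> of the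
  source is translated to a 1-hole context \<open>c'\<close> of the target, and a violation
  \<open>(c, I, P)\<close> of replacement freeness is thereby mapped to the violation
  \<open>(c', enc I, enc P)\<close>.
\<close>

text \<open>Composition of contexts. Holes are not renumbered: the entries of \<open>cs\<close> keep
  their own numbers and share one numbering in the result, so a single list fills all of
  them.\<close>

primrec subst_ctxt :: "'f ctxt list \<Rightarrow> 'f ctxt \<Rightarrow> 'f ctxt" where
  "subst_ctxt cs (Hole i) = cs ! i"
| "subst_ctxt cs (Node f ds) = Node f (map (subst_ctxt cs) ds)"

lemma holes_subst_ctxt: "holes (subst_ctxt cs d) = concat (map (\<lambda>i. holes (cs ! i)) (holes d))"
proof (induction d)
  case (Node f ds)
  then show ?case by (induction ds) auto
qed simp

text \<open>The bound on the holes matters at a hole \<open>i\<close>, where \<open>nth\<close>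
  commutes with \<open>map\<close> only for indices within the list.\<close>

lemma fill_subst_ctxt:
  assumes "set (holes d) \<subseteq> {..<length cs}"
  shows "fill C (subst_ctxt cs d) Ps = fill C d (map (\<lambda>c. fill C c Ps) cs)"
  using assms
proof (induction d)
  case (Node f ds)
  then have "map (\<lambda>d. fill C (subst_ctxt cs d) Ps) ds
      = map (\<lambda>d. fill C d (map (\<lambda>c. fill C c Ps) cs)) ds"
    by (intro map_cong) auto
  then show ?case by (simp add: comp_def cong: map_cong)
qed simp

lemma wf_ctxt_subst_ctxt:
  assumes "wf_ctxt C d" and "set (holes d) \<subseteq> {..<length cs}" and "\<forall>c\<in>set cs. wf_ctxt C c"
  shows "wf_ctxt C (subst_ctxt cs d)"
  using assms
proof (induction rule: wf_ctxt.induct)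
  case (node f ds)
  have "set (holes c) \<subseteq> {..<length cs}" if "c \<in> set ds" for c
    using node.prems(1) that by auto
  then show ?case using node by (auto intro!: wf_ctxt.node)
qed simp

lemma hole_ctxt_holes: "hole_ctxt C k c \<Longrightarrow> set (holes c) = {..<k}"
  unfolding hole_ctxt_def by (metis atLeast_upt set_mset_mset)

text \<open>Each number below \<open>length cs\<close> occurs exactly once in \<open>d\<close>, so
  every entry of \<open>cs\<close> is plugged in exactly once. The order of the holes of
  \<open>d\<close> is arbitrary, hence the passage to multisets.\<close>

lemma mset_holes_subst_hole_ctxt:
  assumes "hole_ctxt C (length cs) d"
  shows "mset (holes (subst_ctxt cs d)) = mset (concat (map holes cs))"
proof -
  have "mset (holes (subst_ctxt cs d)) = (\<Sum>i\<in>#mset (holes d). mset (holes (cs ! i)))"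
    by (simp add: holes_subst_ctxt mset_concat comp_def flip: sum_mset_sum_list)
  also have "\<dots> = (\<Sum>i\<in>#mset [0..<length cs]. mset (holes (cs ! i)))"
    using assms by (simp add: hole_ctxt_def)
  also have "\<dots> = mset (concat (map (\<lambda>i. holes (cs ! i)) [0..<length cs]))"
    by (simp add: mset_concat comp_def flip: sum_mset_sum_list)
  also have "map (\<lambda>i. holes (cs ! i)) [0..<length cs] = map holes cs"
    by (rule nth_equalityI) auto
  finally show ?thesis .
qed

lemma fill_in_procs:
  assumes "wf_ctxt C c" and "set (holes c) \<subseteq> {..<length Ps}" and "set Ps \<subseteq> procs C"
  shows "fill C c Ps \<in> procs C"
  using assms
proof (induction rule: wf_ctxt.induct)
  case (hole i)
  then show ?case by auto
next
  case (node f cs)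
  have "set (holes c) \<subseteq> {..<length Ps}" if "c \<in> set cs" for c
    using node.prems(1) that by auto
  then show ?case using node by (auto intro!: procs.op)
qed

text \<open>The subcontexts of a 1-hole context may have no hole, and those of a
  \<open>k\<close>-hole context may use any part of the numbers below \<open>k\<close>. For the
  induction to go through, the claim therefore covers arbitrary well-formed contexts, keeps track of
  the multiset of holes, and allows every list \<open>Ps\<close> long enough to fill them.\<close>

lemma compositional_ctxt:
  assumes "compositional C D enc" and "wf_ctxt C c"
  shows "\<exists>c'. wf_ctxt D c' \<and> mset (holes c') = mset (holes c) \<and>
    (\<forall>Ps. set (holes c) \<subseteq> {..<length Ps} \<longrightarrow> set Ps \<subseteq> procs C \<longrightarrow>
       enc (fill C c Ps) = fill D c' (map enc Ps))"
  using assms(2)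
proof (induction rule: wf_ctxt.induct)
  case (hole i)
  show ?case by (rule exI[of _ "Hole i"]) (auto intro: wf_ctxt.hole)
next
  case (node f cs)
  obtain d where d: "hole_ctxt D (length cs) d"
    and enc: "\<And>Ps. length Ps = length cs \<Longrightarrow> set Ps \<subseteq> procs C \<Longrightarrow>
      enc (app C f Ps) = fill D d (map enc Ps)"
    using assms(1) node(1,2) unfolding compositional_def by metis
  \<comment> \<open>The induction hypothesis gives a translation of each argument context;
    \<open>t\<close> chooses one. Plugging these into the context \<open>d\<close> of the operator
    \<open>f\<close> translates the whole node.\<close>
  obtain t where t: "\<And>c. c \<in> set cs \<Longrightarrow> wf_ctxt D (t c)"
      "\<And>c. c \<in> set cs \<Longrightarrow> mset (holes (t c)) = mset (holes c)"
      "\<And>c Ps. c \<in> set cs \<Longrightarrow> set (holes c) \<subseteq> {..<length Ps} \<Longrightarrow> set Ps \<subseteq> procs C \<Longrightarrow>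
        enc (fill C c Ps) = fill D (t c) (map enc Ps)"
    and wf: "\<And>c. c \<in> set cs \<Longrightarrow> wf_ctxt C c"
    using node(3) by metis
  let ?c' = "subst_ctxt (map t cs) d"
  have holes_d: "set (holes d) \<subseteq> {..<length (map t cs)}"
    using hole_ctxt_holes[OF d] by simp
  have "wf_ctxt D ?c'"
    using d t(1) holes_d by (intro wf_ctxt_subst_ctxt) (auto simp: hole_ctxt_def)
  moreover have "mset (holes ?c') = mset (holes (Node f cs))"
  proof -
    have "mset (holes ?c') = mset (concat (map (holes \<circ> t) cs))"
      using mset_holes_subst_hole_ctxt[of D "map t cs" d] d by simp
    also have "\<dots> = sum_list (map (\<lambda>c. mset (holes (t c))) cs)"
      by (simp add: mset_concat comp_def)
    also have "\<dots> = sum_list (map (\<lambda>c. mset (holes c)) cs)"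
      using t(2) by (metis (mono_tags, lifting) map_eq_conv)
    finally show ?thesis by (simp add: mset_concat comp_def)
  qed
  moreover have "enc (fill C (Node f cs) Ps) = fill D ?c' (map enc Ps)"
    if Ps: "set (holes (Node f cs)) \<subseteq> {..<length Ps}" "set Ps \<subseteq> procs C" for Ps
  proof -
    have sub: "set (holes c) \<subseteq> {..<length Ps}" if "c \<in> set cs" for c
      using Ps(1) that by auto
    \<comment> \<open>Compositionality speaks of operators applied to processes only, so the filled
      argument contexts must first be shown to lie in \<open>procs C\<close>.\<close>
    have "enc (fill C (Node f cs) Ps) = fill D d (map enc (map (\<lambda>c. fill C c Ps) cs))"
      unfolding fill.simps using fill_in_procs[OF wf sub Ps(2)] by (intro enc) auto
    also have "map enc (map (\<lambda>c. fill C c Ps) cs) = map (\<lambda>c. fill D c (map enc Ps)) (map t cs)"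
      using t(3) sub Ps(2) by simp
    finally show ?thesis
      by (simp only: fill_subst_ctxt[OF holes_d])
  qed
  ultimately show ?case by blast
qed

lemma compositional_hole_ctxt:
  assumes "compositional C D enc" and "hole_ctxt C k c"
  obtains c' where "hole_ctxt D k c'"
    and "\<And>Ps. length Ps = k \<Longrightarrow> set Ps \<subseteq> procs C \<Longrightarrow>
      enc (fill C c Ps) = fill D c' (map enc Ps)"
  using compositional_ctxt[OF assms(1), of c] assms(2) hole_ctxt_holes[OF assms(2)]
  unfolding hole_ctxt_def by auto

lemma independence_preserving_closed:
  assumes "independence_preserving C D enc" and "P \<in> procs C" and "closed_proc C P"
  shows "closed_proc D (enc P)"
  using assms unfolding independence_preserving_def independent_def closed_proc_def by blast

lemma replacement_free_if_encodable:
  assumes basic: "basic_encoding C D enc" and indep: "independence_preserving C D enc"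
    and free: "replacement_free D"
  shows "replacement_free C"
  unfolding replacement_free_def
proof (intro allI impI)
  fix c I P
  assume c: "hole_ctxt C 1 c" and I: "I \<in> procs C" "closed_proc C I" "\<not> visible C I"
    and P: "P \<in> procs C" and vis: "visible C (fill C c [I])"
  have sens: "visible C Q \<longleftrightarrow> visible D (enc Q)" and proc: "enc Q \<in> procs D"
    if "Q \<in> procs C" for Q
    using basic that
    by (auto simp: basic_encoding_def interaction_sensitive_def encoding_def)
  obtain c' where c': "hole_ctxt D 1 c'"
    and fill: "\<And>Ps. length Ps = 1 \<Longrightarrow> set Ps \<subseteq> procs C \<Longrightarrow>
      enc (fill C c Ps) = fill D c' (map enc Ps)"
    using compositional_hole_ctxt[OF _ c] basic unfolding basic_encoding_def by metis
  have fill_proc: "fill C c [Q] \<in> procs C" if "Q \<in> procs C" for Q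
    using c hole_ctxt_holes[OF c] that by (intro fill_in_procs) (auto simp: hole_ctxt_def)
  \<comment> \<open>Interaction sensitivity is used here at the filled context, which is itself a
    process of \<open>C\<close>.\<close>
  have trans: "visible C (fill C c [Q]) \<longleftrightarrow> visible D (fill D c' [enc Q])"
    if "Q \<in> procs C" for Q
    using sens[OF fill_proc[OF that]] fill[of "[Q]"] that by simp
  \<comment> \<open>Replacement freeness of \<open>D\<close> applies to \<open>c'\<close>,
    \<open>enc I\<close> and \<open>enc P\<close>: \<open>enc I\<close> is closed by independence
    preservation and invisible by interaction sensitivity.\<close>
  have "visible D (fill D c' [enc P])"
    using free c' proc[OF I(1)] independence_preserving_closed[OF indep I(1,2)]
      sens[OF I(1)] I(3) proc[OF P] trans[OF I(1)] vis
    unfolding replacement_free_def by blast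
  then show "visible C (fill C c [P])"
    using trans[OF P] by simp
qed

theorem theorem2p13:
  fixes C1 :: "('p, 'f, 'n, 'a) calculus" and C2 :: "('q, 'g, 'm, 'b) calculus"
  assumes "process_calculus C1" and "process_calculus C2"
    and "\<not> replacement_free C1" and "replacement_free C2"
  shows "\<not> (\<exists>enc. basic_encoding C1 C2 enc \<and> independence_preserving C1 C2 enc)"
  using assms(3,4) replacement_free_if_encodable by blast

end
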